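(* Let $n,m\ge 1$ be integers and let $Q := \{(\mathbf{x},\mathbf{y})\in\mathbb{R}^n\times\mathbb{R}^m : \|\mathbf{x}\|\le\|\mathbf{y}\|\}$. Let $C\subseteq \mathbb{R}^n\times\mathbb{R}^m$ be a full-dimensional closed convex maximal $Q$-free set. Then there exists a function $\Gamma : D^m\to D^n$ such that $C = C_\Gamma$, where $$C_\Gamma := \{(\mathbf{x},\mathbf{y}) \in \mathbb{R}^n \times \mathbb{R}^m : \Gamma(\boldsymbol{\beta})^\top \mathbf{x} - \boldsymbol{\beta}^\top \mathbf{y} \ge 0 \ \text{ for all } \boldsymbol{\beta} \in D^m\}.$$
   Context: $\|\cdot\|$ is the Euclidean norm, and $D^k := \{\mathbf{x}\in\mathbb{R}^k : \|\mathbf{x}\|=1\}$. Given a closed set $S\subseteq\mathbb{R}^d$, a closed convex set $C\subseteq\mathbb{R}^d$ is $S$-free if its interior contains no point of $S$; it is a maximal $S$-free set if it is $S$-free and is not strictly contained in another ($S$-free, closed convex) set. $Q$-free means $S$-free with $S=Q$ in $\mathbb{R}^n\times\mathbb{R}^m$. A convex set is full-dimensional if it has nonempty interior (equivalently, it is nonempty and not contained in a hyperplane). The function $\Gamma$ is an arbitrary function (no continuity is assumed). *)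

theory Defs
  imports "HOL-Analysis.Analysis"
begin

definition S_free :: "'a::euclidean_space set \<Rightarrow> 'a set \<Rightarrow> bool" where
  "S_free S C \<longleftrightarrow> closed C \<and> convex C \<and> interior C \<inter> S = {}"

definition maximal_S_free :: "'a::euclidean_space set \<Rightarrow> 'a set \<Rightarrow> bool" where
  "maximal_S_free S C \<longleftrightarrow> S_free S C \<and> \<not> (\<exists>C'. S_free S C' \<and> C \<subset> C')"

definition full_dimensional :: "'a::euclidean_space set \<Rightarrow> bool" where
  "full_dimensional C \<longleftrightarrow> interior C \<noteq> {}"

definition Q :: "((real^'n) \<times> (real^'m)) set" where
  "Q = {(x, y). norm x \<le> norm y}"

definition D :: "(real^'k) set" where
  "D = {x. norm x = 1}"

text \<open>Only the values of \<open>\<Gamma>\<close> on \<open>D\<close> matter for \<open>C_Gamma \<Gamma>\<close>.\<close>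

definition C_Gamma :: "(real^'m \<Rightarrow> real^'n) \<Rightarrow> ((real^'n) \<times> (real^'m)) set" where
  "C_Gamma \<Gamma> = {(x, y). \<forall>\<beta>\<in>D. \<Gamma> \<beta> \<bullet> x - \<beta> \<bullet> y \<ge> 0}"

end

(* Fix a unit vector \<beta>. The convex cone {(x, y). norm x \<le> \<beta> \<bullet> y} lies in Q, so it can be
   separated from C. It contains {0} \<times> \<beta>^\<bottom>, so the separating inequality has the form
   \<gamma> \<bullet> x - \<beta> \<bullet> y \<ge> 0 with norm \<gamma> \<le> 1. The projection of interior C to the x-space omits 0, so
   some v \<noteq> 0 satisfies v \<bullet> x \<ge> 0 on C. Adding a multiple of v makes \<gamma> a unit vector. This yields
   \<Gamma> with C \<subseteq> C_Gamma \<Gamma>; as C_Gamma \<Gamma> is always Q-free, maximality forces equality. *)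

theory Submission
  imports Defs
begin

lemma C_Gamma_eq_Inter: "C_Gamma \<Gamma> = (\<Inter>\<beta>\<in>D. {z. (\<Gamma> \<beta>, - \<beta>) \<bullet> z \<ge> 0})"
  by (auto simp: C_Gamma_def)

text \<open>For y \<noteq> 0 the witness is \<open>sgn y\<close>. As \<open>sgn 0 = 0\<close> is not
  a unit vector, y = 0 takes an arbitrary one.\<close>

lemma exists_D_inner_eq_norm: "\<exists>\<beta>\<in>D. \<beta> \<bullet> y = norm y" for y :: "real^'m"
proof (cases "y = 0")
  case True
  obtain u :: "real^'m" where "norm u = 1"
    using vector_choose_size[of 1] by auto
  with True show ?thesis by (auto simp: D_def)
next
  case False
  then have "sgn y \<in> D" "sgn y \<bullet> y = norm y"
    by (auto simp: D_def norm_sgn sgn_div_norm power2_norm_eq_inner[symmetric] power2_eq_square)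
  then show ?thesis by blast
qed

text \<open>At a point (x, y) of \<open>Q\<close>, take the \<beta> aligned with y. Then
  \<open>\<Gamma> \<beta> \<bullet> x \<le> norm x \<le> norm y = \<beta> \<bullet> y\<close>,
  whereas an interior point satisfies the inequality for \<beta> strictly.\<close>

lemma S_free_C_Gamma:
  fixes \<Gamma> :: "real^'m \<Rightarrow> real^'n"
  assumes \<Gamma>: "\<Gamma> \<in> D \<rightarrow> D"
  shows "S_free Q (C_Gamma \<Gamma>)"
  unfolding S_free_def
proof (intro conjI)
  show "closed (C_Gamma \<Gamma>)" "convex (C_Gamma \<Gamma>)"
    unfolding C_Gamma_eq_Inter
    by (auto intro!: closed_INT convex_INT closed_halfspace_ge convex_halfspace_ge)
  show "interior (C_Gamma \<Gamma>) \<inter> Q = {}"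
  proof safe
    fix x :: "real^'n" and y :: "real^'m"
    assume int: "(x, y) \<in> interior (C_Gamma \<Gamma>)" and "(x, y) \<in> Q"
    then have le: "norm x \<le> norm y" by (simp add: Q_def)
    obtain \<beta> where \<beta>: "\<beta> \<in> D" "\<beta> \<bullet> y = norm y"
      using exists_D_inner_eq_norm by blast
    have norms: "norm \<beta> = 1" "norm (\<Gamma> \<beta>) = 1" using \<Gamma> \<beta>(1) by (auto simp: D_def)
    have "C_Gamma \<Gamma> \<subseteq> {z. (\<Gamma> \<beta>, - \<beta>) \<bullet> z \<ge> 0}"
      using \<beta>(1) by (auto simp: C_Gamma_def)
    then have "(x, y) \<in> interior {z. (\<Gamma> \<beta>, - \<beta>) \<bullet> z \<ge> 0}"
      using int interior_mono by blast
    moreover have "(\<Gamma> \<beta>, - \<beta>) \<noteq> 0" using norms by (auto simp: zero_prod_def)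
    ultimately have "\<Gamma> \<beta> \<bullet> x > \<beta> \<bullet> y"
      by (simp add: interior_halfspace_ge)
    moreover have "\<Gamma> \<beta> \<bullet> x \<le> norm x"
      using norm_cauchy_schwarz[of "\<Gamma> \<beta>" x] norms by simp
    ultimately show "(x, y) \<in> {}" using le \<beta>(2) by simp
  qed
qed

text \<open>A convex set with nonempty interior lies in the closure of that interior. This carries
  bounds over to \<open>C\<close> from \<open>interior C\<close>, the set that is disjoint from
  \<open>Q\<close> and hence can be separated.\<close>

lemma inner_ge_if_interior:
  fixes C :: "'a::euclidean_space set"
  assumes "convex C" "interior C \<noteq> {}" "\<And>z. z \<in> interior C \<Longrightarrow> a \<bullet> z \<ge> c" "z \<in> C"
  shows "a \<bullet> z \<ge> c"
proof -
  have "closure (interior C) \<subseteq> {z. a \<bullet> z \<ge> c}"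
    using assms(3) by (intro closure_minimal closed_halfspace_ge) auto
  then show ?thesis
    using convex_closure_interior[OF assms(1,2)] closure_subset assms(4) by blast
qed

lemma Q_free_valid_normal_le_1:
  fixes C :: "((real^'n) \<times> (real^'m)) set"
  assumes free: "S_free Q C" and full: "interior C \<noteq> {}" and \<beta>: "norm \<beta> = 1"
  obtains \<gamma> where "norm \<gamma> \<le> 1" "\<And>x y. (x, y) \<in> C \<Longrightarrow> \<gamma> \<bullet> x \<ge> \<beta> \<bullet> y"
proof -
  define W where "W = {(x :: real^'n, y :: real^'m). norm x \<le> \<beta> \<bullet> y}"
  have conv: "convex C" and disj: "interior C \<inter> Q = {}"
    using free by (auto simp: S_free_def)
  have "convex W"
  proof (rule convexI)
    fix w w' :: "(real^'n) \<times> (real^'m)" and s t :: real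
    assume w: "w \<in> W" "w' \<in> W" and st: "s \<ge> 0" "t \<ge> 0" "s + t = 1"
    obtain x y x' y' where eq: "w = (x, y)" "w' = (x', y')" by (metis surj_pair)
    have "norm (s *\<^sub>R x + t *\<^sub>R x') \<le> s * norm x + t * norm x'"
      using norm_triangle_ineq[of "s *\<^sub>R x" "t *\<^sub>R x'"] st by simp
    also have "\<dots> \<le> s * (\<beta> \<bullet> y) + t * (\<beta> \<bullet> y')"
      using w st by (intro add_mono mult_left_mono) (auto simp: W_def eq)
    finally show "s *\<^sub>R w + t *\<^sub>R w' \<in> W"
      by (simp add: W_def eq inner_add_right)
  qed
  moreover have "0 \<in> W" by (simp add: W_def zero_prod_def)
  moreover have "W \<subseteq> Q"
  proof -
    have "norm x \<le> norm y" if "norm x \<le> \<beta> \<bullet> y" for x :: "real^'n" and y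
      using that norm_cauchy_schwarz[of \<beta> y] \<beta> by simp
    then show ?thesis by (auto simp: W_def Q_def)
  qed
  ultimately have W: "convex W" "0 \<in> W" "W \<inter> interior C = {}"
    using disj by blast+
  then obtain a k where a: "a \<noteq> 0" and W_le: "\<forall>w\<in>W. a \<bullet> w \<le> k"
    and C_ge: "\<forall>z\<in>interior C. a \<bullet> z \<ge> k"
    using separating_hyperplane_sets[of W "interior C"] convex_interior[OF conv] full
    by blast
  have k: "k \<ge> 0" using W_le W(2) by fastforce
  \<comment> \<open>\<open>W\<close> is a cone, so a linear functional bounded above on it is
    nonpositive there: otherwise scaling w by r would give the value k + 1.\<close>
  have W_le0: "a \<bullet> w \<le> 0" if "w \<in> W" for w
  proof (rule ccontr)
    assume neg: "\<not> a \<bullet> w \<le> 0"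
    define r where "r = (k + 1) / (a \<bullet> w)"
    have "r \<ge> 0" using neg k by (simp add: r_def)
    then have "r *\<^sub>R w \<in> W"
      using that by (cases w) (simp add: W_def mult_left_mono)
    then have "a \<bullet> (r *\<^sub>R w) \<le> k" using W_le by blast
    moreover have "a \<bullet> (r *\<^sub>R w) = k + 1" using neg by (simp add: r_def)
    ultimately show False by simp
  qed
  obtain p q where pq: "a = (p, q)" by (cases a)
  \<comment> \<open>The component of q along \<beta> is \<open>- s *\<^sub>R \<beta>\<close>; s
    becomes the factor by which the inequality is normalized.\<close>
  define s where "s = - (q \<bullet> \<beta>)"
  have \<beta>\<beta>: "\<beta> \<bullet> \<beta> = 1" using \<beta> by (simp add: dot_square_norm)
  have q: "q = - s *\<^sub>R \<beta>"
  proof -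
    \<comment> \<open>The component of q orthogonal to \<beta>. Since \<open>(0, z)\<close> lies in
      \<open>W\<close>, \<open>z \<bullet> z \<le> 0\<close>.\<close>
    define z where "z = q + s *\<^sub>R \<beta>"
    have orth: "\<beta> \<bullet> z = 0"
      by (simp add: z_def s_def inner_diff_right \<beta>\<beta> inner_commute[of q])
    then have "q \<bullet> z \<le> 0" using W_le0[of "(0, z)"] by (simp add: W_def pq)
    moreover have "q \<bullet> z = z \<bullet> z - s * (\<beta> \<bullet> z)"
      by (simp add: z_def inner_add_left)
    ultimately have "z = 0" using orth inner_ge_zero[of z] by simp
    then show ?thesis by (simp add: z_def eq_neg_iff_add_eq_0)
  qed
  \<comment> \<open>The test point lies on the boundary of \<open>W\<close> with its x-part along p,
    which makes the bound on \<open>norm p\<close> sharp.\<close>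
  have "norm p * norm p \<le> norm p * s"
    using W_le0[of "(p, norm p *\<^sub>R \<beta>)"]
    by (simp add: W_def pq \<beta>\<beta> s_def norm_eq_sqrt_inner)
  moreover have "s \<ge> 0" using W_le0[of "(0, \<beta>)"] by (simp add: W_def pq \<beta>\<beta> s_def)
  ultimately have ps: "norm p \<le> s"
    by (cases "p = 0") auto
  have s: "s > 0"
  proof (rule ccontr)
    assume "\<not> s > 0"
    with ps \<open>s \<ge> 0\<close> have "s = 0" "p = 0" by auto
    then show False using a by (simp add: pq q zero_prod_def)
  qed
  show ?thesis
  proof (rule that)
    show "norm (p /\<^sub>R s) \<le> 1" using ps s by (simp add: field_simps)
    fix x y assume "(x, y) \<in> C"
    then have "a \<bullet> (x, y) \<ge> k"
      using inner_ge_if_interior[OF conv full] C_ge by blast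
    then have "p \<bullet> x \<ge> s * (\<beta> \<bullet> y)" using k by (simp add: pq q)
    then show "(p /\<^sub>R s) \<bullet> x \<ge> \<beta> \<bullet> y" using s by (simp add: field_simps)
  qed
qed

text \<open>Every (0, y) lies in \<open>Q\<close>, so 0 is outside the convex projection of
  \<open>interior C\<close> and can be separated from it.\<close>

lemma Q_free_fst_halfspace:
  fixes C :: "((real^'n) \<times> (real^'m)) set"
  assumes free: "S_free Q C" and full: "interior C \<noteq> {}"
  obtains v where "v \<noteq> 0" "\<And>x y. (x, y) \<in> C \<Longrightarrow> v \<bullet> x \<ge> 0"
proof -
  have conv: "convex C" and disj: "interior C \<inter> Q = {}"
    using free by (auto simp: S_free_def)
  have "convex (fst ` interior C)"
    by (intro convex_linear_image linear_fst convex_interior conv)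
  moreover have "0 \<notin> fst ` interior C"
    using disj by (fastforce simp: Q_def)
  ultimately obtain v where v: "v \<noteq> 0" "\<forall>x\<in>fst ` interior C. v \<bullet> x \<ge> 0"
    using separating_hyperplane_set_0 by blast
  have "v \<bullet> x \<ge> 0" if "(x, y) \<in> C" for x y
    using inner_ge_if_interior[OF conv full, where a = "(v, 0)" and c = 0 and z = "(x, y)"] v(2) that
    by (force simp: inner_prod_def)
  with v(1) show ?thesis using that by blast
qed

text \<open>Intermediate value theorem along the ray from u: the norm is at most c at t = 0, and at
  least c at t = b because \<open>b *\<^sub>R v\<close> has norm \<open>c + norm u\<close>.\<close>

lemma exists_norm_add_scaleR_eq:
  fixes u v :: "'a::real_normed_vector"
  assumes "norm u \<le> c" "v \<noteq> 0"
  shows "\<exists>t\<ge>0. norm (u + t *\<^sub>R v) = c"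
proof -
  define b where "b = (c + norm u) / norm v"
  have c: "c + norm u \<ge> 0" using assms norm_ge_zero[of u] by linarith
  then have b: "b \<ge> 0" by (simp add: b_def)
  have "norm (b *\<^sub>R v) = c + norm u" using assms c by (simp add: b_def)
  then have "norm (u + b *\<^sub>R v) \<ge> c"
    using norm_triangle_ineq4[of "u + b *\<^sub>R v" u] by simp
  then show ?thesis
    using IVT'[of "\<lambda>t. norm (u + t *\<^sub>R v)" 0 c b] assms b
    by (force intro!: continuous_intros)
qed

lemma Q_free_valid_normal:
  fixes C :: "((real^'n) \<times> (real^'m)) set"
  assumes free: "S_free Q C" and full: "interior C \<noteq> {}" and \<beta>: "\<beta> \<in> D"
  shows "\<exists>\<gamma>\<in>D. \<forall>(x, y)\<in>C. \<gamma> \<bullet> x - \<beta> \<bullet> y \<ge> 0"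
proof -
  obtain \<gamma> where \<gamma>: "norm \<gamma> \<le> 1" "\<And>x y. (x, y) \<in> C \<Longrightarrow> \<gamma> \<bullet> x \<ge> \<beta> \<bullet> y"
    using Q_free_valid_normal_le_1[OF free full] \<beta> by (auto simp: D_def)
  obtain v where v: "v \<noteq> 0" "\<And>x y. (x, y) \<in> C \<Longrightarrow> v \<bullet> x \<ge> 0"
    using Q_free_fst_halfspace[OF free full] by blast
  obtain t where t: "t \<ge> 0" "norm (\<gamma> + t *\<^sub>R v) = 1"
    using exists_norm_add_scaleR_eq[OF \<gamma>(1) v(1)] by blast
  \<comment> \<open>Adding \<open>t *\<^sub>R v\<close> keeps the inequality valid, since it changes
    the left side by \<open>t * (v \<bullet> x) \<ge> 0\<close> on \<open>C\<close>.\<close>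
  have "(\<gamma> + t *\<^sub>R v) \<bullet> x - \<beta> \<bullet> y \<ge> 0" if "(x, y) \<in> C" for x y
    using \<gamma>(2)[OF that] mult_nonneg_nonneg[OF t(1) v(2)[OF that]]
    by (simp add: inner_add_left)
  with t(2) show ?thesis by (intro bexI[of _ "\<gamma> + t *\<^sub>R v"]) (auto simp: D_def)
qed

theorem theorem1:
  fixes C :: "((real^'n) \<times> (real^'m)) set"
  assumes "maximal_S_free Q C"
    and "full_dimensional C"
  shows "\<exists>\<Gamma> \<in> D \<rightarrow> D. C = C_Gamma \<Gamma>"
proof -
  have free: "S_free Q C" and full: "interior C \<noteq> {}"
    using assms by (auto simp: maximal_S_free_def full_dimensional_def)
  \<comment> \<open>The normals are chosen independently for each \<beta>, so \<Gamma> need not be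
    continuous.\<close>
  obtain \<Gamma> :: "real^'m \<Rightarrow> real^'n"
    where \<Gamma>: "\<forall>\<beta>\<in>D. \<Gamma> \<beta> \<in> D \<and> (\<forall>(x, y)\<in>C. \<Gamma> \<beta> \<bullet> x - \<beta> \<bullet> y \<ge> 0)"
    using Q_free_valid_normal[OF free full] by metis
  then have "\<Gamma> \<in> D \<rightarrow> D" and "C \<subseteq> C_Gamma \<Gamma>"
    by (auto simp: C_Gamma_def)
  moreover have "\<not> C \<subset> C_Gamma \<Gamma>"
    using assms(1) S_free_C_Gamma[OF \<open>\<Gamma> \<in> D \<rightarrow> D\<close>] by (auto simp: maximal_S_free_def)
  ultimately show ?thesis by blast
qed

end
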